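(* Let $G$ be a finite simple graph with maximum degree $k \geq 3$, let $M(G)$ be the set of vertices of $G$ of degree $k$, let $t = |M(G)|$, and let $m$ be the number of edges of $G$ that contain at least one vertex of $M(G)$. Suppose $m < kt$. Define \[b_1(k,t,m) = \frac{m + (k-1)t}{2k-1} \quad \text{and} \quad b_2(k,t,m) = m \left( 1 - \frac{k-1}{k}\left(\frac{m}{kt}\right)^{1/(k-1)} \right).\] Let $x_1 > 1$ be the real number $3.512\ldots$ such that $e^{(x_1-1)/2} = x_1$. (a) There exists a unique real number $x_0$ such that $2.088\ldots \leq x_0 < x_1$ and $\left(\frac{2k-1}{2k-x_0}\right)^{k} = x_0$. We have $b_1(k,t,m) < b_2(k,t,m)$ if $m \geq \frac{1}{x_0} kt$. The larger $k$ is, the larger $x_0$ is. Moreover, for any real $\delta > 0$, $x_0 > x_1 - \delta$ if $k$ is sufficiently large. (b) There exists a unique real number $x_0'$ such that $x_1 \leq x_0' < 4$ and $\left(\frac{2k-2}{2k-1}\right)^{1/2} e^{(x_0'-1)/2} = x_0'$. We have $b_2(k,t,m) < b_1(k,t,m)$ if $m \leq \frac{1}{x_0'} kt$. The larger $k$ is, the smaller $x_0'$ is. Moreover, for any real $\delta > 0$, $x_0' < x_1 + \delta$ if $k$ is sufficiently large.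
   Context: Graphs are finite and simple. The quantity $b_1(k,t,m)$ is a known upper bound, and $b_2(k,t,m)$ another known upper bound, on the minimum number of edges whose removal from $G$ decreases the maximum degree; the theorem only compares the two expressions. *)

theory Defs
  imports Complex_Main
begin

definition simple_graph :: "'a set \<Rightarrow> 'a set set \<Rightarrow> bool" where
  "simple_graph V E \<longleftrightarrow> finite V \<and> (\<forall>e\<in>E. e \<subseteq> V \<and> card e = 2)"

definition degree :: "'a set set \<Rightarrow> 'a \<Rightarrow> nat" where
  "degree E v = card {e \<in> E. v \<in> e}"

(* Unspecified for the empty vertex set, which has no maximum degree. *)
definition max_degree :: "'a set \<Rightarrow> 'a set set \<Rightarrow> nat" where
  "max_degree V E = Max (degree E ` V)"

definition max_degree_vertices :: "'a set \<Rightarrow> 'a set set \<Rightarrow> 'a set" where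
  "max_degree_vertices V E = {v \<in> V. degree E v = max_degree V E}"

definition b1 :: "nat \<Rightarrow> nat \<Rightarrow> nat \<Rightarrow> real" where
  "b1 k t m = (real m + (real k - 1) * real t) / (2 * real k - 1)"

definition b2 :: "nat \<Rightarrow> nat \<Rightarrow> nat \<Rightarrow> real" where
  "b2 k t m = real m * (1 - (real k - 1) / real k *
     (real m / (real k * real t)) powr (1 / (real k - 1)))"

definition x1 :: real where
  "x1 = (THE x. x > 1 \<and> exp ((x - 1) / 2) = x)"

(* The constant 2.088...: the solution other than 1 of the equation that defines x0 k for k = 3,
   namely (5 / (6 - x))^3 = x.  It is the least value attained by x0. *)
definition x0_lower :: real where
  "x0_lower = (THE x. 2.088 \<le> x \<and> x < 2.089 \<and> (5 / (6 - x)) ^ 3 = x)"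

definition x0 :: "nat \<Rightarrow> real" where
  "x0 k = (THE x. x0_lower \<le> x \<and> x < x1 \<and>
     ((2 * real k - 1) / (2 * real k - x)) ^ k = x)"

definition x0' :: "nat \<Rightarrow> real" where
  "x0' k = (THE x. x1 \<le> x \<and> x < 4 \<and>
     ((2 * real k - 2) / (2 * real k - 1)) powr (1 / 2) * exp ((x - 1) / 2) = x)"

end

(* With x = k t / m the claim b1 < b2 reads (2k-1) x^(-1/(k-1)) < 2k - x.  After taking logarithms
   the three defining equations concern exp_gap x = (x-1)/2 - ln x and
   pow_gap k x = k ln ((2k-1)/(2k-x)) - ln x, both of which vanish at 1, decrease and then increase.
   x1 and x0 k are their zeros beyond 1, and x0' k solves exp_gap x = ln ((2k-1)/(2k-2)) / 2.
   As k grows, pow_gap k decreases (by Bernoulli's inequality) to exp_gap, which gives the monotonicity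
   and the limit of x0.  Replacing the exponent k by k - 1 makes the inequality at x0 strict.
   The comparison beyond x0' is the tangent inequality for ln at x = 2. *)
theory Submission
  imports Defs "HOL-Real_Asymp.Real_Asymp"
begin

section \<open>Functions that fall and then rise\<close>

text \<open>\<open>f\<close> falls from 0 at \<open>a\<close> to a negative value at
  \<open>c\<close> and then rises to a positive value at \<open>b\<close>, so its one further zero
  lies on the rising branch. The sign pattern is returned with the zero: it yields uniqueness and
  the later comparisons.\<close>

lemma valley_unique_zero:
  fixes f f' :: "real \<Rightarrow> real"
  assumes "a < c" "c < b" "f a = 0" "f b > 0"
    and der: "\<And>x. a \<le> x \<Longrightarrow> x \<le> b \<Longrightarrow> (f has_real_derivative f' x) (at x)"
    and neg: "\<And>x. a < x \<Longrightarrow> x < c \<Longrightarrow> f' x < 0"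
    and pos: "\<And>x. c < x \<Longrightarrow> x \<le> b \<Longrightarrow> f' x > 0"
  obtains z where "c < z" "z < b" "f z = 0"
    "\<And>x. a < x \<Longrightarrow> x < z \<Longrightarrow> f x < 0" "\<And>x. z < x \<Longrightarrow> x \<le> b \<Longrightarrow> f x > 0"
proof -
  have cont: "continuous_on {u..v} f" if "a \<le> u" "v \<le> b" for u v
    using that by (intro continuous_at_imp_continuous_on) (auto intro!: DERIV_isCont der)
  have dec: "f y < f x" if "a \<le> x" "x < y" "y \<le> c" for x y
  proof (rule DERIV_neg_imp_decreasing_open[OF that(2)])
    show "\<exists>d. (f has_real_derivative d) (at u) \<and> d < 0" if "x < u" "u < y" for u
      using that \<open>a \<le> x\<close> \<open>y \<le> c\<close> assms(2) by (intro exI[of _ "f' u"] conjI der neg) auto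
  qed (use that assms(2) cont in auto)
  have inc: "f x < f y" if "c \<le> x" "x < y" "y \<le> b" for x y
  proof (rule DERIV_pos_imp_increasing_open[OF that(2)])
    show "\<exists>d. (f has_real_derivative d) (at u) \<and> d > 0" if "x < u" "u < y" for u
      using that \<open>c \<le> x\<close> \<open>y \<le> b\<close> assms(1) by (intro exI[of _ "f' u"] conjI der pos) auto
  qed (use that assms(1) cont in auto)
  have "f c < 0" using dec[of a c] assms by simp
  then obtain z where z: "c \<le> z" "z \<le> b" "f z = 0"
    using IVT'[of f c 0 b] cont[of c b] assms by auto
  have "z \<noteq> c" "z \<noteq> b" using z \<open>f c < 0\<close> assms by auto
  have "f x < 0" if "a < x" "x < z" for x
    using dec[of a x] inc[of x z] that z assms(3) by (cases "x \<le> c") auto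
  moreover have "f x > 0" if "z < x" "x \<le> b" for x
    using inc[of z x] that z by auto
  ultimately show ?thesis using that[of z] z \<open>z \<noteq> c\<close> \<open>z \<noteq> b\<close> by auto
qed

section \<open>Logarithmic forms of the defining equations\<close>

definition exp_gap :: "real \<Rightarrow> real" where
  "exp_gap x = (x - 1) / 2 - ln x"

text \<open>The logarithm of the quotient is kept split, which makes the derivative in x simply
  k/(2k-x) - 1/x.\<close>

definition pow_gap :: "nat \<Rightarrow> real \<Rightarrow> real" where
  "pow_gap k x = real k * (ln (2 * real k - 1) - ln (2 * real k - x)) - ln x"

lemma exp_eq_iff_exp_gap: "x > 0 \<Longrightarrow> exp ((x - 1) / 2) = x \<longleftrightarrow> exp_gap x = 0"
  unfolding exp_gap_def by (metis eq_iff_diff_eq_0 exp_ln ln_exp)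

lemma pow_gap_eq_ln:
  assumes "0 < x" "x < 2 * real k" "k \<ge> 1"
  shows "pow_gap k x = ln (((2 * real k - 1) / (2 * real k - x)) ^ k) - ln x"
proof -
  have "ln ((2 * real k - 1) / (2 * real k - x)) = ln (2 * real k - 1) - ln (2 * real k - x)"
    by (rule ln_divide_pos) (use assms in linarith)+
  then show ?thesis by (simp add: pow_gap_def ln_realpow)
qed

text \<open>For x < 2k the power is positive, so logarithms can be compared. The inequality form
  reduces the sign checks that locate \<open>x0_lower\<close> to rational arithmetic.\<close>

lemma
  assumes "0 < x" "x < 2 * real k" "k \<ge> 1"
  shows power_eq_iff_pow_gap: "((2 * real k - 1) / (2 * real k - x)) ^ k = x \<longleftrightarrow> pow_gap k x = 0"
    and power_le_iff_pow_gap: "((2 * real k - 1) / (2 * real k - x)) ^ k \<le> x \<longleftrightarrow> pow_gap k x \<le> 0"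
proof -
  have "((2 * real k - 1) / (2 * real k - x)) ^ k > 0"
    by (intro zero_less_power divide_pos_pos) (use assms in linarith)+
  then show "((2 * real k - 1) / (2 * real k - x)) ^ k = x \<longleftrightarrow> pow_gap k x = 0"
    and "((2 * real k - 1) / (2 * real k - x)) ^ k \<le> x \<longleftrightarrow> pow_gap k x \<le> 0"
    unfolding pow_gap_eq_ln[OF assms]
    using assms(1) ln_inj_iff[of _ x] ln_le_cancel_iff[of _ x] by simp_all
qed

lemma powr_exp_eq_iff_exp_gap:
  assumes "k \<ge> 2" "x > 0"
  shows "((2 * real k - 2) / (2 * real k - 1)) powr (1 / 2) * exp ((x - 1) / 2) = x \<longleftrightarrow>
    exp_gap x = ln ((2 * real k - 1) / (2 * real k - 2)) / 2" (is "?l = x \<longleftrightarrow> _")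
proof -
  have p: "(2 * real k - 2) / (2 * real k - 1) > 0" using assms by auto
  then have "?l > 0" by (intro mult_pos_pos) auto
  then have "?l = x \<longleftrightarrow> ln ?l = ln x" using assms by (simp del: ln_mult)
  also have "ln ?l = ln ((2 * real k - 2) / (2 * real k - 1)) / 2 + (x - 1) / 2"
    using p by (subst ln_mult) (auto simp: ln_powr)
  also have "ln ((2 * real k - 2) / (2 * real k - 1)) = - ln ((2 * real k - 1) / (2 * real k - 2))"
    using assms by (simp add: ln_div)
  finally show ?thesis unfolding exp_gap_def by linarith
qed

lemma exp_gap_strict_mono:
  assumes "2 \<le> x" "x < y" shows "exp_gap x < exp_gap y"
proof (rule DERIV_pos_imp_increasing_open[OF assms(2)])
  fix z assume "x < z" "z < y"
  then show "\<exists>d. (exp_gap has_real_derivative d) (at z) \<and> d > 0"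
    using assms unfolding exp_gap_def
    by (intro exI[of _ "1/2 - 1/z"]) (auto intro!: derivative_eq_intros simp: field_simps)
next
  show "continuous_on {x..y} exp_gap"
    unfolding exp_gap_def using assms by (intro continuous_intros) auto
qed

section \<open>Numerical estimates and the constant \<open>x1\<close>\<close>

lemma exp_3_gt_20: "exp (3::real) > 20"
proof -
  obtain s :: real where "exp 1 = (\<Sum>m<8. 1 ^ m / fact m) + exp s / fact 8 * 1 ^ 8"
    using Maclaurin_exp_le[of 1 8] by auto
  moreover have "exp s / fact 8 > 0" by simp
  ultimately have "exp (1::real) > (\<Sum>m<8. 1 ^ m / fact m)" by simp
  \<comment> \<open>The eight Taylor terms sum to about 2.71825, and the cube of 2.718 is about
    20.08.\<close>
  then have "exp (1::real) > 2.718" by (simp add: eval_nat_numeral)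
  then have "(2.718::real) ^ 3 < exp 1 ^ 3" by (intro power_strict_mono) auto
  moreover have "exp 1 ^ 3 = exp (3::real)" by (simp add: exp_of_nat_mult[symmetric])
  ultimately show ?thesis by (simp add: eval_nat_numeral)
qed

text \<open>Doubling turns the claim into ln 20 < 3, because 4^2 * 5/4 = 20. The number 5/4 is
  (2k-1)/(2k-2) at k = 3, so this is what keeps \<open>x0' k\<close> below 4.\<close>

lemma exp_gap_4: "exp_gap 4 > ln (5 / 4) / 2"
proof -
  have "ln 20 < (3::real)"
    using exp_3_gt_20 by (metis exp_gt_zero ln_exp ln_less_cancel_iff zero_less_numeral)
  moreover have "ln (20::real) = 2 * ln 4 + ln (5/4)"
    using ln_mult[of 16 "5/4"] ln_realpow[of 4 2] by simp
  ultimately show ?thesis by (simp add: exp_gap_def)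
qed

text \<open>Here exp 1.256 must be bounded from above, where 1.256 = (3.512-1)/2. Passing to the
  reciprocal turns this into a lower bound for exp (-1.256), which a Taylor sum with nonnegative
  remainder provides.\<close>

lemma exp_gap_3512: "exp_gap 3.512 < 0"
proof -
  obtain s :: real where s: "\<bar>s\<bar> \<le> \<bar>-1.256\<bar>"
      "exp (-1.256) = (\<Sum>m<10. (-1.256) ^ m / fact m) + exp s / fact 10 * (-1.256) ^ 10"
    using Maclaurin_exp_le[of "-1.256" 10] by auto
  have "exp s / fact 10 * (-1.256) ^ 10 \<ge> 0" by simp
  then have "exp (-1.256::real) \<ge> (\<Sum>m<10. (-1.256) ^ m / fact m)" using s by linarith
  then have "exp (-1.256::real) > 1/3.512" by (simp add: eval_nat_numeral)
  then have "ln (1/3.512::real) < ln (exp (-1.256))" by (subst ln_less_cancel_iff) simp_all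
  then show ?thesis by (simp add: exp_gap_def ln_div)
qed

lemma exp_gap_3513: "exp_gap 3.513 > 0"
proof -
  obtain s :: real where s: "exp 1.2565 = (\<Sum>m<12. 1.2565 ^ m / fact m) + exp s / fact 12 * 1.2565 ^ 12"
    using Maclaurin_exp_le[of "1.2565" 12] by auto
  have "exp s / fact 12 * 1.2565 ^ 12 \<ge> 0" by simp
  then have "exp (1.2565::real) \<ge> (\<Sum>m<12. 1.2565 ^ m / fact m)" using s by linarith
  then have "exp (1.2565::real) > 3.513" by (simp add: eval_nat_numeral)
  then have "ln (3.513::real) < ln (exp 1.2565)" by (subst ln_less_cancel_iff) simp_all
  then show ?thesis by (simp add: exp_gap_def)
qed

lemma exp_gap_sign:
  obtains z where "3.512 < z" "z < 3.513" "exp_gap z = 0"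
    "\<And>x. 1 < x \<Longrightarrow> x < z \<Longrightarrow> exp_gap x < 0" "\<And>x. z < x \<Longrightarrow> exp_gap x > 0"
proof -
  obtain z where z: "2 < z" "z < 3.513" "exp_gap z = 0" "\<And>x. 1 < x \<Longrightarrow> x < z \<Longrightarrow> exp_gap x < 0"
  \<comment> \<open>The derivative 1/2 - 1/x vanishes at 2; beyond 3.513 the sign comes from
    \<open>exp_gap_strict_mono\<close>.\<close>
  proof (rule valley_unique_zero[of 1 2 "3.513" exp_gap "\<lambda>x. 1/2 - 1/x"])
    show "(exp_gap has_real_derivative 1/2 - 1/x) (at x)" if "1 \<le> x" for x
      unfolding exp_gap_def using that by (auto intro!: derivative_eq_intros)
  qed (use exp_gap_3513 in \<open>auto simp: exp_gap_def field_simps\<close>)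
  moreover have "3.512 < z"
    using exp_gap_3512 z exp_gap_strict_mono[of z "3.512"] by (cases "z = 3.512"; cases "z < 3.512") auto
  ultimately show ?thesis using that exp_gap_strict_mono[of z] by (metis less_imp_le)
qed

lemma ex1_x1: "\<exists>!x::real. x > 1 \<and> exp ((x - 1) / 2) = x"
proof -
  obtain z where z: "3.512 < z" "exp_gap z = 0"
    "\<And>x. 1 < x \<Longrightarrow> x < z \<Longrightarrow> exp_gap x < 0" "\<And>x. z < x \<Longrightarrow> exp_gap x > 0"
    using exp_gap_sign by metis
  show ?thesis
  proof (rule ex1I[of _ z])
    fix x :: real assume "x > 1 \<and> exp ((x - 1) / 2) = x"
    then show "x = z" using z(3,4)[of x] exp_eq_iff_exp_gap[of x] by (cases x z rule: linorder_cases) auto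
  qed (use z exp_eq_iff_exp_gap[of z] in auto)
qed

lemma
  shows x1_gt: "3.512 < x1" and x1_less: "x1 < 3.513" and exp_gap_x1: "exp_gap x1 = 0"
    and exp_gap_neg: "\<And>x. 1 < x \<Longrightarrow> x < x1 \<Longrightarrow> exp_gap x < 0" and exp_gap_pos: "\<And>x. x1 < x \<Longrightarrow> exp_gap x > 0"
proof -
  obtain z where z: "3.512 < z" "z < 3.513" "exp_gap z = 0"
    "\<And>x. 1 < x \<Longrightarrow> x < z \<Longrightarrow> exp_gap x < 0" "\<And>x. z < x \<Longrightarrow> exp_gap x > 0"
    using exp_gap_sign by metis
  have "x1 = z" unfolding x1_def
    by (rule the1_equality[OF ex1_x1]) (use z exp_eq_iff_exp_gap[of z] in auto)
  with z show "3.512 < x1" "x1 < 3.513" "exp_gap x1 = 0"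
    "\<And>x. 1 < x \<Longrightarrow> x < x1 \<Longrightarrow> exp_gap x < 0" "\<And>x. x1 < x \<Longrightarrow> exp_gap x > 0" by auto
qed

section \<open>Dependence of \<open>pow_gap\<close> on k\<close>

text \<open>Apply ln u <= u - 1 to u = (2k-x)/(2k-1), then use k/(2k-1) > 1/2. At \<open>x1\<close>
  this makes \<open>pow_gap k\<close> positive, which forces its zero below
  \<open>x1\<close>.\<close>

lemma pow_gap_gt_exp_gap:
  assumes "k \<ge> 1" "1 < x" "x < 2 * real k"
  shows "exp_gap x < pow_gap k x"
proof -
  have "ln ((2 * real k - x) / (2 * real k - 1)) \<le> (2 * real k - x) / (2 * real k - 1) - 1"
    using assms by (intro ln_le_minus_one) auto
  also have "\<dots> = - ((x - 1) / (2 * real k - 1))" using assms by (simp add: field_simps)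
  finally have "ln (2 * real k - 1) - ln (2 * real k - x) \<ge> (x - 1) / (2 * real k - 1)"
    using assms by (simp add: ln_div del: minus_divide_left)
  then have "real k * (ln (2 * real k - 1) - ln (2 * real k - x)) \<ge> real k * ((x - 1) / (2 * real k - 1))"
    by (intro mult_left_mono) auto
  moreover have "real k * ((x - 1) / (2 * real k - 1)) > (x - 1) / 2"
    using assms by (simp add: field_simps)
  ultimately show ?thesis unfolding pow_gap_def exp_gap_def by linarith
qed

text \<open>The same logarithm bound for the reciprocal quotient. The right-hand side tends to
  \<open>exp_gap x\<close> as k grows, which drives the limit of \<open>x0\<close>.\<close>

lemma pow_gap_le:
  assumes "k \<ge> 1" "1 < x" "x < 2 * real k"
  shows "pow_gap k x \<le> real k * ((x - 1) / (2 * real k - x)) - ln x"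
proof -
  have "ln ((2 * real k - 1) / (2 * real k - x)) \<le> (2 * real k - 1) / (2 * real k - x) - 1"
    using assms by (intro ln_le_minus_one) auto
  also have "\<dots> = (x - 1) / (2 * real k - x)" using assms by (simp add: field_simps)
  finally have "ln (2 * real k - 1) - ln (2 * real k - x) \<le> (x - 1) / (2 * real k - x)"
    using assms by (simp add: ln_div)
  then show ?thesis unfolding pow_gap_def by (intro diff_right_mono mult_left_mono) auto
qed

text \<open>With a and b as below the claim is a^k < b^(k+1), that is 1/a < (b/a)^(k+1), and
  Bernoulli's inequality bounds the right-hand side from below.\<close>

lemma pow_gap_Suc_less:
  assumes "k \<ge> 1" "1 < x" "x < 2 * real k"
  shows "pow_gap (Suc k) x < pow_gap k x"
proof -
  define a where "a = (2 * real k - x) / (2 * real k - 1)"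
  define b where "b = (2 * real k + 2 - x) / (2 * real k + 1)"
  have ab: "a > 0" "b > 0" using assms by (auto simp: a_def b_def)
  have a: "a = 1 - (x - 1) / (2 * real k - 1)" and b: "b = 1 - (x - 1) / (2 * real k + 1)"
    using assms by (auto simp: a_def b_def field_simps)
  \<comment> \<open>Since b - a = 2(x-1)/((2k-1)(2k+1)), the factor k+1 lifts it above 1 - a =
    (x-1)/(2k-1), because 2k+2 > 2k+1.\<close>
  have "1 < a + (real k + 1) * (b - a)"
    unfolding a b using assms by (simp add: divide_simps) (simp add: algebra_simps)
  then have "1 / a < 1 + real (Suc k) * (b / a - 1)"
    using ab by (simp add: field_simps)
  also have "\<dots> \<le> (1 + (b / a - 1)) ^ Suc k"
    using ab by (intro Bernoulli_inequality) auto
  finally have "1 / a < (b / a) ^ Suc k" by simp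
  then have "a ^ k < b ^ Suc k"
    using ab by (simp add: power_divide field_simps)
  then have "ln (a ^ k) < ln (b ^ Suc k)" using ab by simp
  then have "real k * ln a < real (Suc k) * ln b"
    using ab by (simp only: ln_realpow)
  moreover have "ln a = ln (2 * real k - x) - ln (2 * real k - 1)"
    and "ln b = ln (2 * real (Suc k) - x) - ln (2 * real (Suc k) - 1)"
    using assms by (auto simp: a_def b_def ln_div algebra_simps)
  ultimately show ?thesis by (simp add: pow_gap_def algebra_simps)
qed

lemma pow_gap_strict_antimono:
  assumes "i < j" "i \<ge> 1" "1 < x" "x < 2 * real i"
  shows "pow_gap j x < pow_gap i x"
  using assms
proof (induction j rule: less_induct)
  case (less j)
  then obtain l where "j = Suc l" by (cases j) auto
  then show ?case
    using less pow_gap_Suc_less[of l x] by (cases "l = i") force+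
qed

section \<open>The zeros \<open>x0 k\<close>\<close>

lemma pow_gap_sign:
  assumes "k \<ge> 3"
  obtains z where "1 < z" "z < x1" "pow_gap k z = 0"
    "\<And>x. 1 < x \<Longrightarrow> x < z \<Longrightarrow> pow_gap k x < 0" "\<And>x. z < x \<Longrightarrow> x \<le> x1 \<Longrightarrow> pow_gap k x > 0"
proof -
  \<comment> \<open>The turning point: k/(2k-x) = 1/x has this solution.\<close>
  let ?c = "2 * real k / (real k + 1)"
  have c: "1 < ?c" "?c < 2" using assms by (auto simp: field_simps)
  obtain z where "?c < z" "z < x1" "pow_gap k z = 0"
    "\<And>x. 1 < x \<Longrightarrow> x < z \<Longrightarrow> pow_gap k x < 0" "\<And>x. z < x \<Longrightarrow> x \<le> x1 \<Longrightarrow> pow_gap k x > 0"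
  proof (rule valley_unique_zero[of 1 ?c x1 "pow_gap k" "\<lambda>x. real k / (2 * real k - x) - 1 / x"])
    show "pow_gap k x1 > 0" using pow_gap_gt_exp_gap[of k x1] exp_gap_x1 x1_gt x1_less assms by auto
    show "(pow_gap k has_real_derivative real k / (2 * real k - x) - 1 / x) (at x)"
      if "1 \<le> x" "x \<le> x1" for x
      unfolding pow_gap_def using that assms x1_less
      by (auto intro!: derivative_eq_intros simp: field_simps)
    show "real k / (2 * real k - x) - 1 / x < 0" if "1 < x" "x < ?c" for x
    proof -
      have "x < 2 * real k" using that c assms by linarith
      then show ?thesis using that assms by (simp add: field_simps)
    qed
    show "real k / (2 * real k - x) - 1 / x > 0" if "?c < x" "x \<le> x1" for x
    proof -
      have "0 < x" using that c by linarith
      moreover have "x < 2 * real k" using that x1_less assms by simp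
      ultimately show ?thesis using that assms by (simp add: field_simps)
    qed
  qed (use c x1_gt in \<open>auto simp: pow_gap_def\<close>)
  moreover have "1 < z" using c(1) \<open>?c < z\<close> by linarith
  ultimately show ?thesis using that[of z] by blast
qed

lemma ex1_x0_lower: "\<exists>!x::real. 2.088 \<le> x \<and> x < 2.089 \<and> (5 / (6 - x)) ^ 3 = x"
proof -
  obtain z where z: "1 < z" "z < x1" "pow_gap 3 z = 0"
    "\<And>x. 1 < x \<Longrightarrow> x < z \<Longrightarrow> pow_gap 3 x < 0" "\<And>x. z < x \<Longrightarrow> x \<le> x1 \<Longrightarrow> pow_gap 3 x > 0"
    using pow_gap_sign[of 3] by auto
  have iff: "(5 / (6 - x)) ^ 3 = x \<longleftrightarrow> pow_gap 3 x = 0" "(5 / (6 - x)) ^ 3 \<le> x \<longleftrightarrow> pow_gap 3 x \<le> 0"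
    if "0 < x" "x < 6" for x :: real
    using power_eq_iff_pow_gap[of x 3] power_le_iff_pow_gap[of x 3] that by auto
  \<comment> \<open>The signs at 2.088 and 2.089, read against the sign pattern, trap z between
    them.\<close>
  have "pow_gap 3 2.088 \<le> 0" by (subst iff(2)[symmetric]) (auto simp: eval_nat_numeral)
  then have "2.088 \<le> z" using z(5)[of "2.088"] x1_gt by force
  moreover have "\<not> pow_gap 3 2.089 \<le> 0" by (subst iff(2)[symmetric]) (auto simp: eval_nat_numeral)
  then have "2.089 \<noteq> z" "\<not> 2.089 < z" using z(3) z(4)[of "2.089"] by (metis order_refl, auto)
  then have "z < 2.089" by linarith
  ultimately show ?thesis
  proof (intro ex1I[of _ z])
    fix x :: real assume x: "2.088 \<le> x \<and> x < 2.089 \<and> (5 / (6 - x)) ^ 3 = x"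
    then have "pow_gap 3 x = 0" using iff(1)[of x] by simp
    then show "x = z" using x z(4,5)[of x] x1_gt by (cases x z rule: linorder_cases) auto
  qed (use z iff(1)[of z] in auto)
qed

lemma
  shows x0_lower_ge: "2.088 \<le> x0_lower" and x0_lower_less: "x0_lower < 2.089"
    and pow_gap_3_x0_lower: "pow_gap 3 x0_lower = 0"
proof -
  have "2.088 \<le> x0_lower \<and> x0_lower < 2.089 \<and> (5 / (6 - x0_lower)) ^ 3 = x0_lower"
    unfolding x0_lower_def by (rule theI'[OF ex1_x0_lower])
  then show "2.088 \<le> x0_lower" "x0_lower < 2.089" "pow_gap 3 x0_lower = 0"
    using power_eq_iff_pow_gap[of x0_lower 3] by auto
qed

lemma
  assumes "k \<ge> 3"
  shows ex1_x0: "\<exists>!x. x0_lower \<le> x \<and> x < x1 \<and> ((2 * real k - 1) / (2 * real k - x)) ^ k = x"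
    and x0_ge: "x0_lower \<le> x0 k" and x0_less: "x0 k < x1" and pow_gap_x0: "pow_gap k (x0 k) = 0"
    and pow_gap_neg: "\<And>x. 1 < x \<Longrightarrow> x < x0 k \<Longrightarrow> pow_gap k x < 0"
    and pow_gap_pos: "\<And>x. x0 k < x \<Longrightarrow> x \<le> x1 \<Longrightarrow> pow_gap k x > 0"
proof -
  obtain z where z: "1 < z" "z < x1" "pow_gap k z = 0"
    "\<And>x. 1 < x \<Longrightarrow> x < z \<Longrightarrow> pow_gap k x < 0" "\<And>x. z < x \<Longrightarrow> x \<le> x1 \<Longrightarrow> pow_gap k x > 0"
    using pow_gap_sign[OF assms] by metis
  have iff: "((2 * real k - 1) / (2 * real k - x)) ^ k = x \<longleftrightarrow> pow_gap k x = 0" if "1 < x" "x < x1" for x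
    using power_eq_iff_pow_gap[of x k] that assms x1_less by simp
  \<comment> \<open>\<open>x0_lower\<close> is a zero for k = 3 and \<open>pow_gap\<close> decreases
    in k, so the zero for k cannot lie to its left.\<close>
  have "pow_gap k x0_lower \<le> 0"
    using pow_gap_strict_antimono[of 3 k x0_lower] x0_lower_ge x0_lower_less pow_gap_3_x0_lower assms
    by (cases "k = 3") auto
  then have zl: "x0_lower \<le> z"
    using z(5)[of x0_lower] x0_lower_less x1_gt by force
  show ex1: "\<exists>!x. x0_lower \<le> x \<and> x < x1 \<and> ((2 * real k - 1) / (2 * real k - x)) ^ k = x"
  proof (rule ex1I[of _ z])
    fix x assume x: "x0_lower \<le> x \<and> x < x1 \<and> ((2 * real k - 1) / (2 * real k - x)) ^ k = x"
    then have "pow_gap k x = 0" using iff[of x] x0_lower_ge by simp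
    then show "x = z" using x x0_lower_ge z(4,5)[of x] by (cases x z rule: linorder_cases) auto
  qed (use z zl iff[of z] in auto)
  have "x0 k = z" unfolding x0_def
    by (rule the1_equality[OF ex1]) (use z zl iff[of z] in auto)
  with z zl show "x0_lower \<le> x0 k" "x0 k < x1" "pow_gap k (x0 k) = 0"
    "\<And>x. 1 < x \<Longrightarrow> x < x0 k \<Longrightarrow> pow_gap k x < 0" "\<And>x. x0 k < x \<Longrightarrow> x \<le> x1 \<Longrightarrow> pow_gap k x > 0" by auto
qed

text \<open>At \<open>x0 i\<close> the smaller function \<open>pow_gap j\<close> is already
  negative, so its zero must lie further right.\<close>

lemma x0_strict_mono:
  assumes "3 \<le> i" "i < j"
  shows "x0 i < x0 j"
proof (rule ccontr)
  assume "\<not> x0 i < x0 j"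
  then have "pow_gap j (x0 i) \<ge> 0"
    using pow_gap_pos[of j "x0 i"] pow_gap_x0[of j] x0_less[of i] assms by (cases "x0 i = x0 j") auto
  moreover have "pow_gap j (x0 i) < pow_gap i (x0 i)"
    using x0_ge[of i] x0_less[of i] x0_lower_ge x1_less assms by (intro pow_gap_strict_antimono) auto
  ultimately show False using pow_gap_x0[of i] assms by simp
qed

lemma x0_eventually_gt:
  assumes "\<delta> > 0"
  shows "\<exists>K. \<forall>j\<ge>K. x0 j > x1 - \<delta>"
proof -
  \<comment> \<open>The maximum keeps y inside the interval (1, x1) even for large \<delta>.\<close>
  define y where "y = max 2 (x1 - \<delta>)"
  have y: "1 < y" "y < x1" "x1 - \<delta> \<le> y" using assms x1_gt by (auto simp: y_def)
  \<comment> \<open>The limit \<open>exp_gap y\<close> is negative, so eventually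
    \<open>pow_gap j y\<close> is negative and y lies left of \<open>x0 j\<close>.\<close>
  have "(\<lambda>j. real j * ((y - 1) / (2 * real j - y)) - ln y) \<longlonglongrightarrow> exp_gap y"
    unfolding exp_gap_def by real_asymp
  then have "eventually (\<lambda>j. real j * ((y - 1) / (2 * real j - y)) - ln y < 0) sequentially"
    using exp_gap_neg[of y] y by (intro order_tendstoD) auto
  then have "eventually (\<lambda>j. x0 j > x1 - \<delta>) sequentially"
    using eventually_ge_at_top[of 3]
  proof eventually_elim
    case (elim j)
    then have "pow_gap j y < 0" using pow_gap_le[of j y] y x1_less by auto
    then have "y < x0 j" 
      using elim pow_gap_pos[of j y] pow_gap_x0[of j] y by (cases y "x0 j" rule: linorder_cases) auto
    then show ?case using y by simp
  qed
  then show ?thesis by (simp add: eventually_sequentially)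
qed

section \<open>The solutions \<open>x0' k\<close>\<close>

lemma
  assumes "k \<ge> 3"
  shows ex1_x0': "\<exists>!x. x1 \<le> x \<and> x < 4 \<and>
      ((2 * real k - 2) / (2 * real k - 1)) powr (1 / 2) * exp ((x - 1) / 2) = x"
    and x0'_ge: "x1 \<le> x0' k"
    and exp_gap_x0': "exp_gap (x0' k) = ln ((2 * real k - 1) / (2 * real k - 2)) / 2"
proof -
  let ?e = "ln ((2 * real k - 1) / (2 * real k - 2)) / 2"
  \<comment> \<open>The quotient is 1 + 1/(2k-2), hence largest at k = 3. The target value therefore
    lies between \<open>exp_gap x1\<close> = 0 and \<open>exp_gap 4\<close>.\<close>
  have "(2 * real k - 1) / (2 * real k - 2) \<le> 5 / 4" using assms by (simp add: field_simps)
  then have "?e \<le> ln (5 / 4) / 2" using assms by simp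
  then have "?e < exp_gap 4" using exp_gap_4 by simp
  moreover have "?e \<ge> 0" using assms by simp
  moreover have "continuous_on {x1..4} exp_gap"
    unfolding exp_gap_def using x1_gt by (intro continuous_intros) auto
  ultimately obtain z where z: "x1 \<le> z" "z \<le> 4" "exp_gap z = ?e"
    using IVT'[of exp_gap x1 ?e 4] exp_gap_x1 x1_less by auto
  with \<open>?e < exp_gap 4\<close> have "z \<noteq> 4" by auto
  have iff: "((2 * real k - 2) / (2 * real k - 1)) powr (1 / 2) * exp ((x - 1) / 2) = x \<longleftrightarrow> exp_gap x = ?e"
    if "x1 \<le> x" for x
    using powr_exp_eq_iff_exp_gap[of k x] that assms x1_gt by simp
  show ex1: "\<exists>!x. x1 \<le> x \<and> x < 4 \<and>
      ((2 * real k - 2) / (2 * real k - 1)) powr (1 / 2) * exp ((x - 1) / 2) = x"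
  proof (rule ex1I[of _ z])
    fix x assume x: "x1 \<le> x \<and> x < 4 \<and>
      ((2 * real k - 2) / (2 * real k - 1)) powr (1 / 2) * exp ((x - 1) / 2) = x"
    then have "exp_gap x = exp_gap z" using iff[of x] z by simp
    then show "x = z" using x z x1_gt exp_gap_strict_mono[of x z] exp_gap_strict_mono[of z x]
      by (cases x z rule: linorder_cases) auto
  qed (use z \<open>z \<noteq> 4\<close> iff[of z] in auto)
  have "x0' k = z" unfolding x0'_def
    by (rule the1_equality[OF ex1]) (use z \<open>z \<noteq> 4\<close> iff[of z] in auto)
  with z \<open>z \<noteq> 4\<close> show "x1 \<le> x0' k" "exp_gap (x0' k) = ?e" by auto
qed

text \<open>The prescribed value of \<open>exp_gap\<close> falls as k grows, and
  \<open>exp_gap\<close> increases beyond 2.\<close>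

lemma x0'_strict_antimono:
  assumes "3 \<le> i" "i < j"
  shows "x0' j < x0' i"
proof (rule ccontr)
  assume "\<not> x0' j < x0' i"
  then have "exp_gap (x0' i) \<le> exp_gap (x0' j)"
    using exp_gap_strict_mono[of "x0' i" "x0' j"] x0'_ge[of i] x1_gt assms
    by (cases "x0' i = x0' j") auto
  moreover have "(2 * real j - 1) / (2 * real j - 2) < (2 * real i - 1) / (2 * real i - 2)"
    using assms by (simp add: field_simps)
  then have "exp_gap (x0' j) < exp_gap (x0' i)"
    using assms by (simp add: exp_gap_x0')
  ultimately show False by simp
qed

lemma x0'_eventually_less:
  assumes "\<delta> > 0"
  shows "\<exists>K. \<forall>j\<ge>K. x0' j < x1 + \<delta>"
proof -
  have "(\<lambda>j. ln ((2 * real j - 1) / (2 * real j - 2)) / 2) \<longlonglongrightarrow> 0"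
    by real_asymp
  then have "eventually (\<lambda>j. ln ((2 * real j - 1) / (2 * real j - 2)) / 2 < exp_gap (x1 + \<delta>)) sequentially"
    using exp_gap_pos[of "x1 + \<delta>"] assms by (intro order_tendstoD) auto
  then have "eventually (\<lambda>j. x0' j < x1 + \<delta>) sequentially"
    using eventually_ge_at_top[of 3]
  proof eventually_elim
    case (elim j)
    then have "exp_gap (x0' j) < exp_gap (x1 + \<delta>)" by (simp add: exp_gap_x0')
    then show ?case
      using exp_gap_strict_mono[of "x1 + \<delta>" "x0' j"] assms x1_gt
      by (cases "x1 + \<delta>" "x0' j" rule: linorder_cases) auto
  qed
  then show ?thesis by (simp add: eventually_sequentially)
qed

section \<open>Comparison of \<open>b1\<close> and \<open>b2\<close>\<close>

text \<open>The prefactor is positive, so the sign of the difference is that of the last factor. The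
  root is written through \<open>exp\<close> so that logarithmic inequalities can be exponentiated
  directly.\<close>

lemma b2_minus_b1:
  assumes "k \<ge> 2" "t > 0" "m > 0"
  defines "x \<equiv> real k * real t / real m"
  shows "b2 k t m - b1 k t m = real m * (real k - 1) / (real k * (2 * real k - 1)) *
    (2 * real k - x - (2 * real k - 1) * exp (- ln x / (real k - 1)))"
proof -
  have x: "x > 0" and m: "real m / (real k * real t) = 1 / x" using assms by auto
  have e: "(1 / x) powr (1 / (real k - 1)) = exp (- ln x / (real k - 1))"
    using x by (simp add: powr_def ln_div)
  have t: "real t = x * real m / real k" using assms by (auto simp: x_def)
  show ?thesis
    unfolding b1_def b2_def m e unfolding t
    using assms(1,3) by (simp add: divide_simps) (simp add: algebra_simps)
qed

lemma b1_less_b2: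
  assumes "k \<ge> 3" "m < k * t" "real m \<ge> 1 / x0 k * (real k * real t)"
  shows "b1 k t m < b2 k t m"
proof -
  have x0: "x0 k > 1" "x0 k < 4"
    using x0_ge[of k] x0_less[of k] x0_lower_ge x1_less assms by auto
  have t: "t > 0" using assms(2) by (cases t) auto
  then have "1 / x0 k * (real k * real t) > 0" using assms x0 by simp
  then have m: "m > 0" using assms(3) by (cases m) auto
  define x where "x = real k * real t / real m"
  have "real m < real k * real t" using assms(2) by (metis of_nat_less_iff of_nat_mult)
  then have x: "1 < x" "x \<le> x0 k"
    using assms(3) m x0 by (auto simp: x_def field_simps)
  then have "pow_gap k x \<le> 0"
    using pow_gap_neg[of k x] pow_gap_x0[of k] assms by (cases "x = x0 k") auto
  then have "real k * (ln (2 * real k - 1) - ln (2 * real k - x)) \<le> ln x" by (simp add: pow_gap_def)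
  \<comment> \<open>As x > 1 this difference of logarithms is positive. Removing one of its k copies
    makes the bound strict, also at x = \<open>x0 k\<close>.\<close>
  moreover have "ln (2 * real k - 1) > ln (2 * real k - x)" using x x0 assms by simp
  ultimately have "(real k - 1) * (ln (2 * real k - 1) - ln (2 * real k - x)) < ln x"
    by (simp add: algebra_simps)
  then have "ln (2 * real k - 1) + - ln x / (real k - 1) < ln (2 * real k - x)"
    using assms by (simp add: field_simps)
  then have "exp (ln (2 * real k - 1) + - ln x / (real k - 1)) < exp (ln (2 * real k - x))"
    by simp
  then have "(2 * real k - 1) * exp (- ln x / (real k - 1)) < 2 * real k - x"
    unfolding exp_add using x x0 assms by simp
  then have "b2 k t m - b1 k t m > 0"
    using b2_minus_b1[of k t m] assms t m by (simp flip: x_def)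
  then show ?thesis by simp
qed

lemma b2_less_b1:
  assumes "k \<ge> 3" "m < k * t" "real m \<le> 1 / x0' k * (real k * real t)"
  shows "b2 k t m < b1 k t m"
proof (cases "m = 0")
  \<comment> \<open>Treated apart because x has m in its denominator; here \<open>b2\<close> is 0
    and \<open>b1\<close> is positive.\<close>
  case True
  have "t > 0" using assms(2) by (cases t) auto
  then show ?thesis using True assms by (simp add: b1_def b2_def)
next
  case False
  \<comment> \<open>In terms of n, 2k - 2 is n - 1 and k - 1 is (n-1)/2.\<close>
  define n where "n = 2 * real k - 1"
  have n: "n \<ge> 5" using assms by (simp add: n_def)
  have x0': "x0' k > 3" using x0'_ge[of k] x1_gt assms by auto
  have t: "t > 0" using assms(2) by (cases t) auto
  define x where "x = real k * real t / real m"
  have x: "x0' k \<le> x" using assms(3) False x0' by (auto simp: x_def field_simps)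
  then have "ln (n / (n - 1)) / 2 \<le> exp_gap x"
    using exp_gap_x0'[of k] exp_gap_strict_mono[of "x0' k" x] x0' assms
    by (cases "x = x0' k") (auto simp: n_def)
  then have lnx: "ln x \<le> (x - 1) / 2 - ln (n / (n - 1)) / 2"
    unfolding exp_gap_def by linarith
  have "n * exp (- ln x / (real k - 1)) > n + 1 - x"
  \<comment> \<open>Only below n + 1 can the logarithm of n + 1 - x be taken; otherwise the
    right-hand side is at most 0 and the left-hand side is positive.\<close>
  proof (cases "x < n + 1")
    case True
    \<comment> \<open>\<open>x = 2\<close> is the point of tangency at which the bound below is sharp.\<close>
    have "ln ((n + 1 - x) / (n - 1)) \<le> (n + 1 - x) / (n - 1) - 1"
      using True n by (intro ln_le_minus_one) auto
    then have 1: "(n - 1) / 2 * ln ((n + 1 - x) / (n - 1)) \<le> (2 - x) / 2"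
      using n by (simp add: field_simps)
    \<comment> \<open>Equality in ln v <= v - 1 holds only at v = 1. This is the source of
      strictness, also at x = \<open>x0' k\<close>.\<close>
    have "(n - 1) / n > 0" "(n - 1) / n \<noteq> 1" using n by auto
    then have "ln ((n - 1) / n) < (n - 1) / n - 1"
      using ln_le_minus_one[of "(n - 1) / n"] ln_eq_minus_one[of "(n - 1) / n"] by linarith
    also have "(n - 1) / n - 1 = - (1 / n)" using n by (simp add: diff_divide_distrib)
    finally have "1 / n < ln (n / (n - 1))" using n by (simp add: ln_div)
    then have 2: "1 / 2 < n / 2 * ln (n / (n - 1))"
      using n by (simp add: pos_divide_less_eq mult.commute)
    \<comment> \<open>Split (x-1)/2 as 1/2 - (2-x)/2 and replace 1/2 by the larger bound from
      2.\<close>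
    have "ln x < n / 2 * ln (n / (n - 1)) - ln (n / (n - 1)) / 2 - (2 - x) / 2"
      using lnx 2 by argo
    also have "\<dots> \<le> n / 2 * ln (n / (n - 1)) - ln (n / (n - 1)) / 2
        - (n - 1) / 2 * ln ((n + 1 - x) / (n - 1))"
      using 1 by (rule diff_left_mono)
    \<comment> \<open>The coefficients of ln (n/(n-1)) add up to (n-1)/2, and then ln (n-1)
      cancels.\<close>
    also have "\<dots> = (n - 1) / 2 * (ln n - ln (n + 1 - x))"
      using n True by (simp add: ln_div) (simp add: field_simps)
    finally have "ln x < (n - 1) / 2 * (ln n - ln (n + 1 - x))" .
    then have "ln (n + 1 - x) < ln n + - ln x / (real k - 1)"
      using assms n by (simp add: n_def field_simps)
    then have "exp (ln (n + 1 - x)) < exp (ln n + - ln x / (real k - 1))" by simp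
    then show ?thesis unfolding exp_add using True n by simp
  next
    case False
    moreover have "n * exp (- ln x / (real k - 1)) > 0" using n by simp
    ultimately show ?thesis by linarith
  qed
  then have "2 * real k - x - (2 * real k - 1) * exp (- ln x / (real k - 1)) < 0"
    by (simp add: n_def)
  moreover have "real m * (real k - 1) / (real k * (2 * real k - 1)) > 0"
    using False assms by simp
  moreover have "k \<ge> 2" "m > 0" using assms(1) False by auto
  ultimately have "b2 k t m - b1 k t m < 0"
    using b2_minus_b1[of k t m] t mult_pos_neg by (metis x_def)
  then show ?thesis by simp
qed

theorem theorem2p1:
  fixes V :: "'a set" and E :: "'a set set" and k t m :: nat
  assumes "simple_graph V E"
    and "max_degree V E = k" and "k \<ge> 3"
    and "t = card (max_degree_vertices V E)"
    and "m = card {e \<in> E. \<exists>v \<in> max_degree_vertices V E. v \<in> e}"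
    and "m < k * t"
  shows
    "(\<exists>!x::real. x > 1 \<and> exp ((x - 1) / 2) = x) \<and> 3.512 \<le> x1 \<and> x1 < 3.513 \<and>
     (\<exists>!x::real. 2.088 \<le> x \<and> x < 2.089 \<and> (5 / (6 - x)) ^ 3 = x) \<and>
     \<comment> \<open>(a)\<close>
     ((\<forall>j\<ge>3. \<exists>!x::real. x0_lower \<le> x \<and> x < x1 \<and>
         ((2 * real j - 1) / (2 * real j - x)) ^ j = x) \<and>
      (real m \<ge> 1 / x0 k * (real k * real t) \<longrightarrow> b1 k t m < b2 k t m) \<and>
      (\<forall>i j. 3 \<le> i \<and> i < j \<longrightarrow> x0 i < x0 j) \<and>
      (\<forall>\<delta>>0. \<exists>K. \<forall>j\<ge>K. x0 j > x1 - \<delta>)) \<and>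
     \<comment> \<open>(b)\<close>
     ((\<forall>j\<ge>3. \<exists>!x::real. x1 \<le> x \<and> x < 4 \<and>
         ((2 * real j - 2) / (2 * real j - 1)) powr (1 / 2) * exp ((x - 1) / 2) = x) \<and>
      (real m \<le> 1 / x0' k * (real k * real t) \<longrightarrow> b2 k t m < b1 k t m) \<and>
      (\<forall>i j. 3 \<le> i \<and> i < j \<longrightarrow> x0' j < x0' i) \<and>
      (\<forall>\<delta>>0. \<exists>K. \<forall>j\<ge>K. x0' j < x1 + \<delta>))"
  using assms ex1_x1 x1_gt x1_less ex1_x0_lower ex1_x0 b1_less_b2 x0_strict_mono x0_eventually_gt
    ex1_x0' b2_less_b1 x0'_strict_antimono x0'_eventually_less
  by (auto simp: less_imp_le)

end
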